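(* Let $q$ be an odd prime power, let $k = q^2+1$, and let $t$ be a primitive element of the finite field $\mathbb{F}_{q^2}$. Suppose that there is an element $\zeta \in \mathbb{F}_{q^2}$ such that $\zeta^2 = 3$. Then there is at least one $u$ of the form $u = t^j$ with $j \in \{1,2,\ldots,(k-4)/2\}$ such that $u \notin \Omega$, and hence the graph $G_u$ is triangle-free. (Here $\Omega$ and $G_u$ are defined in the context.)
   Context: Let $q$ be a prime power, $k=q^2+1$, and let $K = \mathbb{F}_{q^2} \cup \{\infty\} = \langle t\rangle \cup \{0,\infty\}$ be the set of points of the projective line $PG(1,q^2)$, where $t$ is a primitive element of $\mathbb{F}_{q^2}$, so $\langle t\rangle = \mathbb{F}_{q^2}^{*}$ is cyclic of order $q^2-1 = k-2$. $K^{(2)}$ denotes the set of unordered pairs of distinct elements of $K$; the pair $\{a,b\}$ is written $ab$. Cross-ratio: for $a,b,c,d \in K$ with $a \ne b$ and $c \neq d$, $$(ab|cd) = \frac{(a-c)(b-d)}{(a-d)(b-c)} \in K,$$ with the usual conventions: if $a,b,c,d$ are distinct and one of them is $\infty$, the two factors containing $\infty$ are cancelled (with the appropriate sign, i.e. the value is the limiting one); the value is $0$ if $a=c$ or $b=d$, and $\infty$ if $a=d$ or $b=c$. Swapping $a,b$ or swapping $c,d$ replaces the cross-ratio by its inverse, so for unordered pairs $ab$, $cd$ the unordered set of values $\{\rho,\rho^{-1}\}$ is well defined; one writes $(ab|cd)=\rho^{\pm}$ to mean that the cross-ratio is $\rho$ or $\rho^{-1}$. Graph $G_u$: for $u \in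 \langle t\rangle$ with $u \ne \pm 1$, $G_u$ is the simple graph with vertex-set $V = K^{(2)}$ in which $ab$ and $cd$ are adjacent if and only if $(ab|cd) = u$ or $(ab|cd) = u^{-1}$ (in particular adjacent pairs are disjoint). The set $\Omega$: $$\Omega = \{ v \in K \mid v = x + x^{-1} - 1 \text{ or } v = (x+x^{-1}-1)^{-1} \text{ for some } x \in \langle t \rangle,\ x \ne 1\},$$ with the convention $0^{-1} = \infty$. *)

theory Defs
  imports "HOL-Library.Ramsey" "HOL-Library.Cardinality" "HOL-Number_Theory.Prime_Powers"
begin

text \<open>
  A finite field is a type of class \<^class>\<open>finite\<close> and \<^class>\<open>field\<close>; its order is the cardinality
  of the type. The powers of \<open>t\<close> with natural exponents are the whole cyclic group generated by
  \<open>t\<close>, since the multiplicative group is finite.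
\<close>

definition primitive_element :: "'a::{field,finite} \<Rightarrow> bool" where
  "primitive_element t \<longleftrightarrow> range (\<lambda>i::nat. t ^ i) = UNIV - {0}"

datatype 'a proj_line = Fin 'a | Infty

text \<open>
  The cross-ratio \<open>(ab|cd)\<close>. It is meaningful only for \<open>a \<noteq> b\<close> and \<open>c \<noteq> d\<close>, and then the first two
  conditions below exclude each other. When one of four distinct points is infinite, the two
  factors containing it have quotient tending to 1 in each of the four cases, so that the limiting
  value never carries a sign.
\<close>

fun cross_ratio_distinct ::
  "'a::field proj_line \<Rightarrow> 'a proj_line \<Rightarrow> 'a proj_line \<Rightarrow> 'a proj_line \<Rightarrow> 'a proj_line" where
  "cross_ratio_distinct (Fin a) (Fin b) (Fin c) (Fin d) =
     Fin (((a - c) * (b - d)) / ((a - d) * (b - c)))"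
| "cross_ratio_distinct Infty (Fin b) (Fin c) (Fin d) = Fin ((b - d) / (b - c))"
| "cross_ratio_distinct (Fin a) Infty (Fin c) (Fin d) = Fin ((a - c) / (a - d))"
| "cross_ratio_distinct (Fin a) (Fin b) Infty (Fin d) = Fin ((b - d) / (a - d))"
| "cross_ratio_distinct (Fin a) (Fin b) (Fin c) Infty = Fin ((a - c) / (b - c))"
| "cross_ratio_distinct _ _ _ _ = undefined"

definition cross_ratio ::
  "'a::field proj_line \<Rightarrow> 'a proj_line \<Rightarrow> 'a proj_line \<Rightarrow> 'a proj_line \<Rightarrow> 'a proj_line" where
  "cross_ratio a b c d =
     (if a = c \<or> b = d then Fin 0
      else if a = d \<or> b = c then Infty
      else cross_ratio_distinct a b c d)"

fun proj_inverse :: "'a::field proj_line \<Rightarrow> 'a proj_line" where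
  "proj_inverse (Fin x) = (if x = 0 then Infty else Fin (inverse x))"
| "proj_inverse Infty = Fin 0"

lemma cross_ratio_swap_left:
  assumes "a \<noteq> b" "c \<noteq> d"
  shows "cross_ratio b a c d = proj_inverse (cross_ratio a b c d)"
  using assms
  by (cases a; cases b; cases c; cases d) (auto simp: cross_ratio_def mult.commute)

lemma cross_ratio_swap_right:
  assumes "a \<noteq> b" "c \<noteq> d"
  shows "cross_ratio a b d c = proj_inverse (cross_ratio a b c d)"
  using assms
  by (cases a; cases b; cases c; cases d) (auto simp: cross_ratio_def mult.commute)

text \<open>
  A graph is given by its vertex set and its set of edges, an edge being a set of two vertices.
\<close>

definition triangle_free :: "'v set \<times> 'v set set \<Rightarrow> bool" where
  "triangle_free G \<longleftrightarrow> \<not> (\<exists>T \<in> nsets (fst G) 3. clique T (snd G))"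

text \<open>
  The choice of the order within the pairs does not affect adjacency, by the two swap lemmas.
\<close>

definition pair_adj :: "'a::field \<Rightarrow> 'a proj_line set \<Rightarrow> 'a proj_line set \<Rightarrow> bool" where
  "pair_adj u A B \<longleftrightarrow>
     (\<exists>a b c d. A = {a, b} \<and> a \<noteq> b \<and> B = {c, d} \<and> c \<noteq> d \<and>
        (cross_ratio a b c d = Fin u \<or> cross_ratio a b c d = Fin (inverse u)))"

definition cr_graph :: "'a::field \<Rightarrow> 'a proj_line set set \<times> 'a proj_line set set set" where
  "cr_graph u =
     (nsets UNIV 2, {{A, B} | A B. A \<in> nsets UNIV 2 \<and> B \<in> nsets UNIV 2 \<and> pair_adj u A B})"

lemma pair_adj_disjoint:
  assumes "pair_adj u A B" "u \<noteq> 0"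
  shows "A \<inter> B = {}"
  using assms unfolding pair_adj_def cross_ratio_def by (auto split: if_splits)

lemma cr_graph_simple:
  assumes "u \<noteq> 0"
  shows "snd (cr_graph u) \<subseteq> nsets (fst (cr_graph u)) 2"
proof
  fix e assume "e \<in> snd (cr_graph u)"
  then obtain A B where e: "e = {A, B}" and AB: "A \<in> nsets UNIV 2" "B \<in> nsets UNIV 2"
    and adj: "pair_adj u A B"
    by (auto simp: cr_graph_def)
  from pair_adj_disjoint[OF adj assms] AB(1) have "A \<noteq> B" by (auto simp: nsets_def)
  then show "e \<in> nsets (fst (cr_graph u)) 2"
    using e AB by (simp add: cr_graph_def nsets_def)
qed

text \<open>
  The group generated by a primitive element is the set of all nonzero elements of the field.
\<close>

definition Omega :: "'a::field proj_line set" where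
  "Omega = {v. \<exists>x. x \<noteq> 0 \<and> x \<noteq> 1 \<and>
     (v = Fin (x + inverse x - 1) \<or> v = proj_inverse (Fin (x + inverse x - 1)))}"

end

theory Submission
  imports Defs "HOL-Computational_Algebra.Nth_Powers"
begin

text \<open>
  Moving one vertex of a triangle to \<open>{0, \<infinity>}\<close> by a projective transformation, the other two become
  \<open>{y, u y}\<close> and \<open>{z, u z}\<close>, and their adjacency says that \<open>u\<close> or \<open>u\<^sup>-\<^sup>1\<close> equals \<open>x + x\<^sup>-\<^sup>1 - 1\<close> for
  \<open>x = y / z\<close>. For \<open>u \<noteq> 1\<close>, solvability of these quadratic equations means that \<open>(u + 3) (u - 1)\<close> or
  \<open>(3 u + 1) (u - 1)\<close> is a square. With \<open>u = 1 + 4 / (n - 1)\<close> these products are \<open>n\<close> and \<open>n + 2\<close> up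
  to nonzero square factors, so it suffices to find \<open>n\<close> with both \<open>n\<close> and \<open>n + 2\<close> non-square. If
  there were none, then, \<open>2\<close> and \<open>-1\<close> being squares, the squares would be closed under addition
  and subtraction, making a non-square \<open>g = (g + 2) - 2\<close> a square. The hypothesis that \<open>3\<close> is a
  square excludes \<open>u = 0\<close>.
\<close>

section \<open>Triangles and \<open>\<Omega>\<close>\<close>

lemma diff_divide_swap:
  fixes a b c d :: "'a::field"
  shows "(a - b) / (c - d) = (b - a) / (d - c)"
  by (metis minus_diff_eq minus_divide_divide)

lemma finite_cross_ratio_swap:
  fixes a b c d :: "'a::field"
  shows "(c - a) * (d - b) / ((c - b) * (d - a)) = (a - c) * (b - d) / ((a - d) * (b - c))"
proof -
  have "(c - a) * (d - b) = (a - c) * (b - d)" "(c - b) * (d - a) = (a - d) * (b - c)"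
    by algebra+
  then show ?thesis by simp
qed

lemma cross_ratio_swap_pairs:
  assumes "a \<noteq> b" "c \<noteq> d"
  shows "cross_ratio c d a b = cross_ratio a b c d"
proof (cases "a = c \<or> b = d \<or> a = d \<or> b = c")
  case True
  with assms show ?thesis by (auto simp: cross_ratio_def)
next
  case False
  from False assms show ?thesis
    by (cases a; cases b; cases c; cases d)
      (auto simp: cross_ratio_def intro: finite_cross_ratio_swap diff_divide_swap)
qed

lemma pair_adj_sym: "pair_adj u A B \<Longrightarrow> pair_adj u B A"
  unfolding pair_adj_def by (metis cross_ratio_swap_pairs)

text \<open>Exchanging the two points of \<open>B\<close> inverts the cross-ratio, so the value
  \<open>inverse u\<close> can always be traded for \<open>u\<close>. Later only one case per edge
  at \<open>A\<close> remains.\<close>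

lemma pair_adj_ordered:
  assumes adj: "pair_adj u {a, b} B" and "a \<noteq> b" "u \<noteq> 0"
  obtains c d where "B = {c, d}" "c \<noteq> d" "cross_ratio a b c d = Fin u"
proof -
  obtain a' b' c d where 1: "{a, b} = {a', b'}" "a' \<noteq> b'" "B = {c, d}" "c \<noteq> d"
    "cross_ratio a' b' c d = Fin u \<or> cross_ratio a' b' c d = Fin (inverse u)"
    using adj unfolding pair_adj_def by blast
  have "a = a' \<and> b = b' \<or> a = b' \<and> b = a'"
    using 1(1) by (auto simp: doubleton_eq_iff)
  then have "cross_ratio a b c d = Fin u \<or> cross_ratio a b c d = Fin (inverse u)"
    using 1 cross_ratio_swap_left[of a' b' c d] \<open>u \<noteq> 0\<close> by auto
  then show thesis
  proof
    assume "cross_ratio a b c d = Fin (inverse u)"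
    then have "cross_ratio a b d c = Fin u"
      using cross_ratio_swap_right[of a b c d] 1 assms by simp
    with 1 show thesis by (intro that[of d c]) auto
  qed (use 1 that in auto)
qed

text \<open>
  The coordinate of \<open>p\<close> after a projective transformation taking \<open>a\<close> to \<open>0\<close> and \<open>b\<close> to \<open>\<infinity>\<close>.
\<close>

fun coord :: "'a::field proj_line \<Rightarrow> 'a proj_line \<Rightarrow> 'a proj_line \<Rightarrow> 'a" where
  "coord (Fin a) (Fin b) (Fin p) = (p - a) / (p - b)"
| "coord (Fin a) (Fin b) Infty = 1"
| "coord (Fin a) Infty (Fin p) = p - a"
| "coord Infty (Fin b) (Fin p) = inverse (p - b)"
| "coord _ _ _ = undefined"

lemma coord_nonzero:
  assumes "a \<noteq> b" "p \<notin> {a, b}"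
  shows "coord a b p \<noteq> 0"
  using assms by (cases a; cases b; cases p) auto

text \<open>The difference is \<open>p - r\<close> times factors depending on \<open>p\<close> alone
  or on \<open>r\<close> alone. In a cross-ratio each point contributes its factor once above and
  once below, so these cancel.\<close>

lemma coord_diff_Fin:
  fixes a b :: "'a::field"
  assumes "p \<noteq> b" "r \<noteq> b"
  shows "(p - a) / (p - b) - (r - a) / (r - b) = (a - b) / (p - b) * ((p - r) / (r - b))"
  using assms by (simp add: divide_simps) (simp add: algebra_simps)

lemma coord_diff_Infty:
  fixes a b :: "'a::field"
  assumes "p \<noteq> b"
  shows "(p - a) / (p - b) - 1 = (b - a) / (p - b)"
    and "1 - (p - a) / (p - b) = (a - b) / (p - b)"
  using assms by (simp_all add: divide_simps)

lemma inverse_shift_diff: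
  fixes b :: "'a::field"
  assumes "p \<noteq> b" "r \<noteq> b"
  shows "inverse (p - b) - inverse (r - b) = (r - p) / (p - b) * inverse (r - b)"
  using assms by (simp add: field_simps)

lemmas coord_diffs = coord_diff_Fin coord_diff_Infty inverse_shift_diff

lemma coord_inj:
  assumes "a \<noteq> b" "p \<notin> {a, b}" "q \<notin> {a, b}" "p \<noteq> q"
  shows "coord a b p \<noteq> coord a b q"
proof -
  have "coord a b p - coord a b q \<noteq> 0"
    using assms by (cases a; cases b; cases p; cases q) (auto simp: coord_diffs)
  then show ?thesis by simp
qed

lemma cross_ratio_base:
  assumes "a \<noteq> b" "p \<notin> {a, b}" "q \<notin> {a, b}" "p \<noteq> q"
  shows "cross_ratio a b p q = Fin (coord a b p / coord a b q)"
  using assms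
  by (cases a; cases b; cases p; cases q)
    (auto simp: cross_ratio_def inverse_eq_divide
      intro: finite_cross_ratio_swap diff_divide_swap)

text \<open>Projective invariance of the cross-ratio: it can be computed from the coordinates, which
  are finite even if one of the four points is not.\<close>

lemma cross_ratio_coord:
  assumes "a \<noteq> b" "p \<notin> {a, b}" "q \<notin> {a, b}" "r \<notin> {a, b}" "s \<notin> {a, b}"
    and "distinct [p, q, r, s]"
  shows "cross_ratio p q r s =
    Fin ((coord a b p - coord a b r) * (coord a b q - coord a b s) /
      ((coord a b p - coord a b s) * (coord a b q - coord a b r)))"
  using assms
  by (cases a; cases b; cases p; cases q; cases r; cases s)
    (simp_all add: cross_ratio_def coord_diffs,
      metis finite_cross_ratio_swap mult.commute)

lemma triangle_imp_Omega:
  fixes u :: "'a::field"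
  assumes "A \<in> nsets UNIV 2" "u \<noteq> 0"
    and AB: "pair_adj u A B" and AC: "pair_adj u A C" and BC: "pair_adj u B C"
  shows "Fin u \<in> Omega"
proof -
  obtain a b where A: "A = {a, b}" "a \<noteq> b"
    using assms(1) by (auto simp: nsets_2_eq)
  obtain c d where B: "B = {c, d}" "c \<noteq> d" "cross_ratio a b c d = Fin u"
    using pair_adj_ordered[of u a b B] AB A \<open>u \<noteq> 0\<close> by auto
  obtain e f where C: "C = {e, f}" "e \<noteq> f" "cross_ratio a b e f = Fin u"
    using pair_adj_ordered[of u a b C] AC A \<open>u \<noteq> 0\<close> by auto
  have disj: "A \<inter> B = {}" "A \<inter> C = {}" "B \<inter> C = {}"
    using AB AC BC \<open>u \<noteq> 0\<close> by (auto dest: pair_adj_disjoint)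
  define h where "h = coord a b"
  have out: "c \<notin> {a, b}" "d \<notin> {a, b}" "e \<notin> {a, b}" "f \<notin> {a, b}"
    and dist: "distinct [c, d, e, f]"
    using disj A B C by auto
  have nz: "h d \<noteq> 0" "h f \<noteq> 0"
    using coord_nonzero A out by (simp_all add: h_def)
  have hc: "h c = u * h d" and he: "h e = u * h f"
    using cross_ratio_base[of a b c d] cross_ratio_base[of a b e f] A B C out nz
    by (simp_all flip: h_def add: divide_eq_eq)
  have ne: "h d \<noteq> h f" "h c \<noteq> h f" "h d \<noteq> h e"
    unfolding h_def by (intro coord_inj \<open>a \<noteq> b\<close> out; use dist in simp)+
  have "u \<noteq> 1"
    using coord_inj[OF \<open>a \<noteq> b\<close>, of c d] out \<open>c \<noteq> d\<close> hc by (auto simp: h_def)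
  \<comment> \<open>The transformation is determined only up to scaling, so only the ratio of the
    two coordinates can matter.\<close>
  define x where "x = h d / h f"
  have hd: "h d = x * h f" using nz by (simp add: x_def)
  have x: "x \<noteq> 0" "x \<noteq> 1" using nz ne hd by auto
  have xu: "u * x \<noteq> 1" "x \<noteq> u" using ne hc he hd nz by auto
  have "cross_ratio c d e f = Fin ((h c - h e) * (h d - h f) / ((h c - h f) * (h d - h e)))"
    unfolding h_def using cross_ratio_coord A out dist by blast
  also have "(h c - h e) * (h d - h f) / ((h c - h f) * (h d - h e)) =
      (h f * h f * (u * (x - 1)\<^sup>2)) / (h f * h f * ((u * x - 1) * (x - u)))"
    unfolding hc he hd by (rule arg_cong2[where f = "(/)"]; algebra)
  also have "\<dots> = (u * (x - 1)\<^sup>2) / ((u * x - 1) * (x - u))" using nz by simp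
  finally have cr: "cross_ratio c d e f = Fin (u * (x - 1)\<^sup>2 / ((u * x - 1) * (x - u)))" .
  obtain e' f' where C': "C = {e', f'}" "e' \<noteq> f'" "cross_ratio c d e' f' = Fin u"
    using pair_adj_ordered[of u c d C] BC B \<open>u \<noteq> 0\<close> by auto
  \<comment> \<open>The orders of \<open>C\<close> that give the value \<open>u\<close> against
    \<open>A\<close> and against \<open>B\<close> need not agree; this is the source of the two
    cases.\<close>
  have "e' = e \<and> f' = f \<or> e' = f \<and> f' = e"
    using C' C by (auto simp: doubleton_eq_iff)
  then have "cross_ratio c d e f = Fin u \<or> cross_ratio c d e f = Fin (inverse u)"
    using cross_ratio_swap_right[of c d f e] B C C' \<open>u \<noteq> 0\<close> by auto
  then show ?thesis
  proof
    assume "cross_ratio c d e f = Fin u"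
    then have "u * (x - 1)\<^sup>2 = u * ((u * x - 1) * (x - u))"
      using cr xu by (simp add: divide_eq_eq)
    then have "(x - 1)\<^sup>2 = (u * x - 1) * (x - u)" using \<open>u \<noteq> 0\<close> by simp
    \<comment> \<open>The unwanted factor \<open>1 - u\<close> splits off; dividing the remaining
      quadratic by \<open>x\<close> gives the formula for \<open>u\<close>.\<close>
    then have "(1 - u) * (x\<^sup>2 - (u + 1) * x + 1) = 0" by algebra
    then have "x\<^sup>2 - (u + 1) * x + 1 = 0" using \<open>u \<noteq> 1\<close> by simp
    then have "u = x + inverse x - 1"
      using x by (simp add: field_simps power2_eq_square)
    then show ?thesis using x by (auto simp: Omega_def)
  next
    assume "cross_ratio c d e f = Fin (inverse u)"
    then have "u * (x - 1)\<^sup>2 = inverse u * ((u * x - 1) * (x - u))"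
      using cr xu by (simp add: divide_eq_eq)
    then have "u * u * (x - 1)\<^sup>2 = u * inverse u * ((u * x - 1) * (x - u))"
      by (simp only: mult.assoc)
    then have "u * u * (x - 1)\<^sup>2 = (u * x - 1) * (x - u)" using \<open>u \<noteq> 0\<close> by simp
    then have "(u - 1) * (u * x\<^sup>2 - (u + 1) * x + u) = 0" by algebra
    then have "u * x\<^sup>2 - (u + 1) * x + u = 0" using \<open>u \<noteq> 1\<close> by simp
    then have "u * (x + inverse x - 1) = 1"
      using x by (simp add: field_simps power2_eq_square)
    then have "x + inverse x - 1 = inverse u" by (metis inverse_unique)
    then have "Fin u = proj_inverse (Fin (x + inverse x - 1))" using \<open>u \<noteq> 0\<close> by simp
    then show ?thesis using x by (auto simp: Omega_def)
  qed
qed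

lemma cr_graph_adj:
  assumes "{A, B} \<in> snd (cr_graph u)"
  shows "pair_adj u A B"
  using assms by (auto simp: cr_graph_def doubleton_eq_iff dest: pair_adj_sym)

lemma triangle_free_cr_graph:
  assumes "u \<noteq> 0" "Fin u \<notin> Omega"
  shows "triangle_free (cr_graph u)"
  unfolding triangle_free_def
proof
  assume "\<exists>T\<in>nsets (fst (cr_graph u)) 3. clique T (snd (cr_graph u))"
  then obtain A B C where *: "A \<in> fst (cr_graph u)" "A \<noteq> B" "A \<noteq> C" "B \<noteq> C"
    and cl: "clique {A, B, C} (snd (cr_graph u))"
    by (auto simp: nsets_3_eq)
  have "A \<in> nsets UNIV 2" using * by (simp add: cr_graph_def)
  moreover have "pair_adj u A B" "pair_adj u A C" "pair_adj u B C"
    using cl * by (auto intro!: cr_graph_adj simp: clique_def)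
  ultimately show False using triangle_imp_Omega assms by blast
qed

text \<open>Inversion exchanges the two alternatives in the definition of \<open>Omega\<close>. This
  allows \<open>u\<close> to be replaced by its inverse when a small exponent is wanted.\<close>

lemma Omega_inverse:
  assumes "Fin (inverse u) \<in> Omega" "u \<noteq> 0"
  shows "Fin u \<in> Omega"
proof -
  obtain x where x: "x \<noteq> 0" "x \<noteq> 1" "Fin (inverse u) = Fin (x + inverse x - 1) \<or>
      Fin (inverse u) = proj_inverse (Fin (x + inverse x - 1))"
    using assms(1) by (auto simp: Omega_def)
  from x(3) have "Fin u = Fin (x + inverse x - 1) \<or> Fin u = proj_inverse (Fin (x + inverse x - 1))"
  proof
    assume "Fin (inverse u) = Fin (x + inverse x - 1)"
    then have "inverse u = x + inverse x - 1" by simp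
    then show ?thesis using \<open>u \<noteq> 0\<close>
      by (metis inverse_inverse_eq inverse_zero_imp_zero proj_inverse.simps(1))
  qed (auto split: if_splits)
  with x show ?thesis unfolding Omega_def by blast
qed

text \<open>The equation \<open>x + inverse x = v + 1\<close> has discriminant
  \<open>(v + 1)^2 - 4 = (v + 3) * (v - 1)\<close>. The first hypothesis excludes
  \<open>v = u\<close>; the second excludes \<open>v = inverse u\<close>, after multiplication by
  \<open>u^2\<close>.\<close>

lemma notin_OmegaI:
  fixes u :: "'a::field"
  assumes "\<not> is_square ((u + 3) * (u - 1))" "\<not> is_square ((3 * u + 1) * (1 - u))"
  shows "Fin u \<notin> Omega"
proof
  assume "Fin u \<in> Omega"
  then obtain x where x: "x \<noteq> 0"
    "Fin u = Fin (x + inverse x - 1) \<or> Fin u = proj_inverse (Fin (x + inverse x - 1))"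
    by (auto simp: Omega_def)
  have sq: "(v + 3) * (v - 1) = (x - inverse x)\<^sup>2" if "v = x + inverse x - 1" for v
    using x(1) unfolding that by (simp add: field_simps power2_eq_square)
  from x(2) show False
  proof
    assume "Fin u = Fin (x + inverse x - 1)"
    then show False using sq[of u] assms(1) by (metis is_nth_power_nth_power proj_line.inject)
  next
    define v where "v = x + inverse x - 1"
    assume "Fin u = proj_inverse (Fin (x + inverse x - 1))"
    then have v: "v \<noteq> 0" "u = inverse v" by (auto simp: v_def split: if_splits)
    have "u * v = 1" using v by simp
    then have "(3 * u + 1) * (1 - u) = ((v + 3) * (v - 1)) * u\<^sup>2" by algebra
    also have "\<dots> = ((x - inverse x) * u)\<^sup>2"
      using sq[of v] by (simp add: v_def power_mult_distrib)
    finally show False using assms(2) by (metis is_nth_power_nth_power)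
  qed
qed

section \<open>Non-squares at distance two\<close>

lemma is_square_mult_square_iff:
  fixes c :: "'a::field"
  assumes "c \<noteq> 0"
  shows "is_square (n * c\<^sup>2) \<longleftrightarrow> is_square n"
proof
  assume "is_square (n * c\<^sup>2)"
  then obtain y where "n * c\<^sup>2 = y\<^sup>2" by (auto simp: is_nth_power_def)
  then have "n = (y / c)\<^sup>2" using assms by (simp add: field_simps)
  then show "is_square n" by (metis is_nth_power_nth_power)
qed (auto intro: is_nth_power_mult)

lemma nonsquare_pair:
  fixes g :: "'a::field"
  assumes m1: "is_square (-1 :: 'a)" and two: "is_square (2 :: 'a)" "(2 :: 'a) \<noteq> 0"
    and g: "\<not> is_square g"
    and mult: "\<And>a b :: 'a. \<lbrakk>\<not> is_square a; \<not> is_square b\<rbrakk> \<Longrightarrow> is_square (a * b)"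
  obtains n :: 'a where "\<not> is_square n" "\<not> is_square (n + 2)"
proof (rule ccontr)
  assume "\<not> thesis"
  with that have step: "is_square (n + 2)" if "\<not> is_square n" for n :: 'a
    using \<open>\<not> is_square n\<close> by blast
  obtain w i :: 'a where w: "2 = w\<^sup>2" and i: "-1 = i\<^sup>2"
    using m1 two by (auto simp: is_nth_power_def)
  have "w \<noteq> 0" using w two by auto
  \<comment> \<open>Scaling by \<open>(w / c)^2\<close> preserves non-squares and turns the
    increment \<open>c^2\<close> into \<open>w^2 = 2\<close>.\<close>
  have nonsquare_add_square: "is_square (n + c\<^sup>2)" if "\<not> is_square n" "c \<noteq> 0" for n c :: 'a
  proof -
    have "is_square (n * (w / c)\<^sup>2 + 2)"
      using step is_square_mult_square_iff[of "w / c" n] that \<open>w \<noteq> 0\<close> by simp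
    also have "n * (w / c)\<^sup>2 + 2 = (n + c\<^sup>2) * (w / c)\<^sup>2"
      unfolding w using that by (simp add: field_simps)
    finally show ?thesis using is_square_mult_square_iff[of "w / c"] that \<open>w \<noteq> 0\<close> by simp
  qed
  \<comment> \<open>If \<open>a + b\<close> were a nonzero square, adding it to the non-square
    \<open>- a\<close> would make \<open>b\<close> a square.\<close>
  have nonsquare_add: "a + b = 0" if ab: "\<not> is_square a" "\<not> is_square b" "is_square (a + b)"
    for a b :: 'a
  proof (rule ccontr)
    assume "a + b \<noteq> 0"
    with ab(3) obtain y where y: "a + b = y\<^sup>2" "y \<noteq> 0" by (auto simp: is_nth_power_def)
    have "- a = a * i\<^sup>2" using i by (metis mult.right_neutral mult_minus_right)
    moreover have "i \<noteq> 0" using i by auto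
    ultimately have "\<not> is_square (- a)" using is_square_mult_square_iff ab(1) by metis
    with nonsquare_add_square[of "- a" y] y have "is_square (- a + (a + b))" by simp
    with ab(2) show False by simp
  qed
  have square_add: "is_square (a\<^sup>2 + b\<^sup>2)" for a b :: 'a
  proof (rule ccontr)
    assume ns: "\<not> is_square (a\<^sup>2 + b\<^sup>2)"
    then have "a \<noteq> 0" "b \<noteq> 0" by auto
    \<comment> \<open>Multiplying by \<open>g\<close> turns a non-square sum of two squares into a
      square sum of two non-squares, which must vanish.\<close>
    then have "g * a\<^sup>2 + g * b\<^sup>2 = 0"
      using mult[OF g ns] g
      by (intro nonsquare_add) (auto simp: is_square_mult_square_iff algebra_simps)
    then have "g * (a\<^sup>2 + b\<^sup>2) = 0" by (simp add: algebra_simps)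
    then show False using g ns by auto
  qed
  obtain y where y: "g + 2 = y\<^sup>2" using step[OF g] by (auto simp: is_nth_power_def)
  \<comment> \<open>This is \<open>g = (g + 2) - 2\<close>, with \<open>i * w\<close> a square root
    of \<open>-2\<close>.\<close>
  have "g = y\<^sup>2 + (i * w)\<^sup>2"
    unfolding power_mult_distrib by (simp flip: y w i)
  then show False using square_add g by metis
qed

section \<open>Squares and primitive elements\<close>

lemma primitive_element_nonzero: "primitive_element t \<Longrightarrow> t \<noteq> 0"
  unfolding primitive_element_def by (metis DiffD2 insertCI power_one_right rangeI)

lemma primitive_element_range:
  assumes "primitive_element t" "0 < m" "t ^ m = 1"
  shows "UNIV - {0} = (\<lambda>i. t ^ i) ` {..<m}"
proof -
  have "t ^ i = t ^ (i mod m)" for i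
    by (metis assms(3) mod_mult_div_eq mult.right_neutral power_add power_mult power_one)
  then have "range (\<lambda>i. t ^ i) = (\<lambda>i. t ^ i) ` {..<m}"
    using \<open>0 < m\<close> by (auto simp: image_iff) (metis lessThan_iff mod_less_divisor)
  then show ?thesis using assms(1) by (simp add: primitive_element_def)
qed

lemma primitive_element_order_le:
  fixes t :: "'a::{field,finite}"
  assumes "primitive_element t" "0 < m" "t ^ m = 1"
  shows "CARD('a) - 1 \<le> m"
proof -
  have "CARD('a) - 1 = card (UNIV - {0 :: 'a})" by (simp add: card_Diff_singleton)
  also have "\<dots> \<le> m"
    unfolding primitive_element_range[OF assms] by (metis card_image_le card_lessThan finite_lessThan)
  finally show ?thesis .
qed

text \<open>Multiplication by \<open>x\<close> permutes the nonzero elements; comparing their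
  products before and after gives the claim.\<close>

lemma finite_field_power_card:
  fixes x :: "'a::{field,finite}"
  assumes "x \<noteq> 0"
  shows "x ^ (CARD('a) - 1) = 1"
proof -
  let ?U = "UNIV - {0 :: 'a}"
  have bij: "bij_betw ((*) x) ?U ?U"
    using assms by (intro bij_betwI[where g = "\<lambda>y. y / x"]) auto
  have "(\<Prod>y\<in>?U. y) = (\<Prod>y\<in>?U. x * y)"
    using prod.reindex_bij_betw[OF bij, of "\<lambda>y. y"] by simp
  also have "\<dots> = x ^ card ?U * (\<Prod>y\<in>?U. y)" by (simp add: prod.distrib)
  finally have "x ^ card ?U = 1" by simp
  then show ?thesis by (simp add: card_Diff_singleton)
qed

lemma primitive_element_half_power:
  fixes t :: "'a::{field,finite}"
  assumes prim: "primitive_element t" and m: "CARD('a) - 1 = 2 * m" "0 < m"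
  shows "t ^ m = -1" and "(1 :: 'a) \<noteq> -1"
proof -
  have "(t ^ m)\<^sup>2 = 1"
    using finite_field_power_card[OF primitive_element_nonzero[OF prim]] m
    by (metis mult.commute power_mult)
  moreover have ne: "t ^ m \<noteq> 1"
    using primitive_element_order_le[OF prim, of m] m by auto
  ultimately show *: "t ^ m = -1" by (simp add: power2_eq_1_iff)
  with ne show "(1 :: 'a) \<noteq> -1" by auto
qed

text \<open>Euler's criterion: the \<open>m\<close>-th power of a nonzero square is 1, while that of
  \<open>t ^ i\<close> is \<open>(-1) ^ i\<close>.\<close>

lemma is_square_primitive_power_iff:
  fixes t :: "'a::{field,finite}"
  assumes prim: "primitive_element t" and m: "CARD('a) - 1 = 2 * m" "0 < m"
  shows "is_square (t ^ i) \<longleftrightarrow> even i"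
proof
  assume "is_square (t ^ i)"
  then obtain y where y: "t ^ i = y\<^sup>2" by (auto simp: is_nth_power_def)
  then have "y \<noteq> 0" using primitive_element_nonzero[OF prim] by auto
  have "(-1) ^ i = (t ^ i) ^ m"
    using primitive_element_half_power[OF assms] by (metis mult.commute power_mult)
  also have "\<dots> = 1"
    unfolding y using finite_field_power_card[OF \<open>y \<noteq> 0\<close>] m by (simp flip: power_mult)
  finally show "even i"
    using primitive_element_half_power(2)[OF assms] by (cases "even i") auto
next
  assume "even i"
  then show "is_square (t ^ i)" by (metis dvdE is_nth_power_nth_power mult.commute power_mult)
qed

text \<open>Inversion reflects the exponent \<open>j\<close> to \<open>2 * m - j\<close>. The
  exponents 0 and \<open>m\<close>, belonging to 1 and -1, are excluded.\<close>

lemma ex_small_power_or_inverse: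
  fixes t u :: "'a::{field,finite}"
  assumes prim: "primitive_element t" and m: "CARD('a) - 1 = 2 * m" "0 < m"
    and u: "u \<noteq> 0" "u \<noteq> 1" "u \<noteq> -1"
  shows "\<exists>j\<in>{1..m - 1}. t ^ j = u \<or> t ^ j = inverse u"
proof -
  have t1: "t ^ (2 * m) = 1"
    using finite_field_power_card[OF primitive_element_nonzero[OF prim]] m by simp
  obtain j where j: "j < 2 * m" "u = t ^ j"
    using primitive_element_range[OF prim _ t1] m u(1) by auto
  have "j \<noteq> 0" "j \<noteq> m"
    using u j primitive_element_half_power(1)[OF prim m] by (auto intro: gr0I)
  show ?thesis
  proof (cases "j < m")
    case True
    then show ?thesis using j \<open>j \<noteq> 0\<close> by (intro bexI[of _ j]) auto
  next
    case False
    have "u * t ^ (2 * m - j) = 1" using j t1 by (simp flip: power_add)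
    then have "t ^ (2 * m - j) = inverse u" by (metis inverse_unique)
    then show ?thesis using False j \<open>j \<noteq> m\<close> by (intro bexI[of _ "2 * m - j"]) auto
  qed
qed

text \<open>This provides an eighth root of unity in the field, and with it square roots of -1 and
  2.\<close>

lemma odd_square_minus_one:
  fixes q :: nat
  assumes "odd q"
  shows "8 dvd q\<^sup>2 - 1"
proof -
  obtain l where l: "q = 2 * l + 1" using assms by (elim oddE)
  have "q\<^sup>2 - 1 = 4 * (l * (l + 1))" unfolding l by (simp add: power2_eq_square algebra_simps)
  moreover have "2 dvd l * (l + 1)" by simp
  ultimately show ?thesis using mult_dvd_mono[of 4 4 2 "l * (l + 1)"] by simp
qed

theorem theorem2:
  fixes q k :: nat and t \<zeta> :: "'a::{field,finite}"
  assumes "primepow q" and "odd q"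
    and "k = q\<^sup>2 + 1"
    and "CARD('a) = q\<^sup>2"
    and "primitive_element t"
    and "\<zeta>\<^sup>2 = 3"
  shows "\<exists>u. (\<exists>j\<in>{1..(k - 4) div 2}. u = t ^ j) \<and> Fin u \<notin> Omega \<and> triangle_free (cr_graph u)"
proof -
  note prim = assms(5)
  obtain e where e: "q\<^sup>2 - 1 = 8 * e" using odd_square_minus_one[OF assms(2)] by (elim dvdE)
  have "1 < q" using assms(1) by (simp add: primepow_gt_Suc_0)
  then have "1 < q\<^sup>2" by (rule one_less_power) simp
  with e have "0 < e" by (cases e) auto
  define m where "m = 4 * e"
  have m: "CARD('a) - 1 = 2 * m" "0 < m" using e \<open>0 < e\<close> assms(4) by (simp_all add: m_def)
  have km: "(k - 4) div 2 = m - 1" using e assms(3) by (simp add: m_def)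
  have t0: "t \<noteq> 0" using primitive_element_nonzero[OF prim] .
  note sq_iff = is_square_primitive_power_iff[OF prim m]
  define w where "w = t ^ e"
  have w4: "w ^ 4 = -1"
    using primitive_element_half_power(1)[OF prim m]
    by (simp add: w_def m_def mult.commute flip: power_mult)
  \<comment> \<open>\<open>w\<close> is a primitive eighth root of unity, so \<open>2 = (w + w\<^sup>-\<^sup>1)\<^sup>2\<close>.\<close>
  define i where "i = w\<^sup>2"
  have i: "i\<^sup>2 = -1" using w4 by (simp add: i_def flip: power_mult)
  have "w \<noteq> 0" using t0 by (simp add: w_def)
  have "(w + inverse w)\<^sup>2 * w\<^sup>2 = 2 * w\<^sup>2 + (w ^ 4 + 1)"
    using \<open>w \<noteq> 0\<close> by (simp add: field_simps power2_eq_square power4_eq_xxxx)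
  then have sqrt2: "(w + inverse w)\<^sup>2 = 2" using w4 \<open>w \<noteq> 0\<close> by simp
  have two: "(2 :: 'a) \<noteq> 0"
    using primitive_element_half_power(2)[OF prim m] by (metis add_eq_0_iff one_add_one)
  have mult: "is_square (a * b)" if "\<not> is_square a" "\<not> is_square b" for a b :: 'a
  proof -
    have "a \<noteq> 0" "b \<noteq> 0" using that by auto
    then obtain i j where "a = t ^ i" "b = t ^ j"
      using prim unfolding primitive_element_def by (metis DiffI UNIV_I imageE singletonD)
    with that show ?thesis by (simp add: sq_iff flip: power_add)
  qed
  have m1: "is_square (-1 :: 'a)" using i by (metis is_nth_power_nth_power)
  have "is_square (2 :: 'a)" using sqrt2 by (metis is_nth_power_nth_power)
  moreover have "\<not> is_square t" using sq_iff[of 1] by simp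
  ultimately obtain n :: 'a where n: "\<not> is_square n" "\<not> is_square (n + 2)"
    using nonsquare_pair[of t] m1 two mult by metis
  \<comment> \<open>Solving \<open>n = (u + 3) / (u - 1)\<close> for \<open>s = u - 1\<close> gives
    this value; then \<open>n + 2 = (3 * u + 1) / (u - 1)\<close>.\<close>
  define s where "s = 4 / (n - 1)"
  define u where "u = 1 + s"
  have "n \<noteq> 1" using n by auto
  have "(4 :: 'a) \<noteq> 0" using two by (metis mult_2_right mult_eq_0_iff numeral_Bit0)
  then have "s \<noteq> 0" using \<open>n \<noteq> 1\<close> by (simp add: s_def)
  have sn: "s * n = s + 4" using \<open>n \<noteq> 1\<close> by (simp add: s_def field_simps)
  have "(u + 3) * (u - 1) = n * s\<^sup>2"
    using sn unfolding u_def by algebra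
  then have u1: "\<not> is_square ((u + 3) * (u - 1))"
    using n(1) \<open>s \<noteq> 0\<close> by (simp add: is_square_mult_square_iff)
  \<comment> \<open>The factor \<open>i\<close> absorbs the sign between \<open>u - 1\<close> and
    \<open>1 - u\<close>.\<close>
  have "(3 * u + 1) * (1 - u) = (n + 2) * (i * s)\<^sup>2"
    using sn i unfolding u_def by algebra
  moreover have "i * s \<noteq> 0" using \<open>s \<noteq> 0\<close> i by auto
  ultimately have u2: "\<not> is_square ((3 * u + 1) * (1 - u))"
    using n(2) by (simp only: is_square_mult_square_iff not_False_eq_True)
  \<comment> \<open>At \<open>u = 0\<close> the first product is -3, a square because 3 and -1 are
    squares.\<close>
  have "u \<noteq> 0"
  proof
    assume "u = 0"
    then have "(u + 3) * (u - 1) = (i * \<zeta>)\<^sup>2" using i assms(6) by (simp add: power_mult_distrib)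
    then show False using u1 by (metis is_nth_power_nth_power)
  qed
  moreover have "u \<noteq> 1" using u1 by auto
  moreover have "u \<noteq> -1"
  \<comment> \<open>At \<open>u = -1\<close> the first product is -4, again a square.\<close>
  proof
    assume "u = -1"
    then have "(u + 3) * (u - 1) = (2 * i)\<^sup>2" using i by (simp add: power_mult_distrib)
    then show False using u1 by (metis is_nth_power_nth_power)
  qed
  ultimately obtain j where j: "j \<in> {1..m - 1}" "t ^ j = u \<or> t ^ j = inverse u"
    using ex_small_power_or_inverse[OF prim m] by blast
  have "Fin (t ^ j) \<notin> Omega"
    using notin_OmegaI[OF u1 u2] Omega_inverse[of u] j(2) \<open>u \<noteq> 0\<close> by auto
  moreover from this have "triangle_free (cr_graph (t ^ j))"
    using t0 by (intro triangle_free_cr_graph) auto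
  ultimately show ?thesis using j(1) unfolding km by blast
qed

end
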